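(* Let $L>0$ and $\delta\in(0,1)$, and set $h_{\mathrm{l}}=\frac{3}{2(1+\delta)}$ and $h_{\mathrm{r}}=\frac{3\delta+2-\sqrt{4-3\delta^2}}{2\delta(\delta+1)}$. The one-step worst-case rates of relatively inexact gradient descent below are attained by univariate functions, as follows. (Left regime.) For every $h\in[0,h_{\mathrm{l}})$ there exist a Huber function $f:\mathbb{R}\to\mathbb{R}$ (convex and $L$-smooth, with minimizer $x_\ast$), a point $x_0$ with $f(x_0)>f(x_\ast)$, and an iterate $x_1$ obtained from $x_0$ by one step of relatively inexact gradient descent with normalized stepsize $h$ and relative inexactness $\delta$, such that $$\frac1L|f'(x_1)|^2=\frac{1}{h(1-\delta)+\frac12}\,\bigl(f(x_0)-f(x_\ast)\bigr).$$ Likewise, for every $h\in(0,h_{\mathrm{l}})$ there exist such a Huber function $f$, a point $x_0$ and an iterate $x_1$ with $f(x_0)>f(x_1)$ and $$\frac1L|f'(x_1)|^2=\frac{1}{h(1-\delta)}\,\bigl(f(x_0)-f(x_1)\bigr).$$ (Right regime.) For every $h\in\left(h_{\mathrm{r}},\frac{2}{1+\delta}\right]$ there exist a convex $L$-smooth quadratic function $f:\mathbb{R}\to\mathbb{R}$ with minimizer $x_\ast$, a point $x_0$ with $f(x_0)>f(x_\ast)$, and an iterate $x_1$ obtained from $x_0$ by one step of relatively inexact gradient descent with normalized stepsize $h$ and relative inexactness $\delta$, such that $$\frac1L|f'(x_1)|^2=2(1-h(1+\delta))^2\,\bigl(f(x_0)-f(x_\ast)\bigr).$$ Likewise, for every $h\in\left(h_{\mathrm{r}},\frac{2}{1+\delta}\right)$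 there exist such a quadratic function $f$, a point $x_0$ and an iterate $x_1$ with $f(x_0)>f(x_1)$ and $$\frac1L|f'(x_1)|^2=\frac{2}{(1-h(1+\delta))^{-2}-1}\,\bigl(f(x_0)-f(x_1)\bigr).$$
   Context: A differentiable function $f:\mathbb{R}\to\mathbb{R}$ is $L$-smooth if $|f'(x)-f'(y)|\le L|x-y|$ for all $x,y$. One step of relatively inexact gradient descent with normalized stepsize $h$ and relative inexactness $\delta$: from $x_0$, some $d_0\in\mathbb{R}$ satisfying $|d_0-f'(x_0)|\le\delta|f'(x_0)|$ is used, and $x_1=x_0-\frac hL d_0$. A Huber function (with curvature $L$) is a function of the form $f(x)=\frac L2x^2$ for $|x|<\tau$ and $f(x)=L\tau|x|-\frac{L\tau^2}{2}$ for $|x|\ge\tau$, for some $\tau>0$. *)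

theory Defs
  imports "HOL-Analysis.Analysis"
begin

definition smooth_fun :: "real \<Rightarrow> (real \<Rightarrow> real) \<Rightarrow> bool" where
  "smooth_fun L f \<longleftrightarrow>
     (\<forall>x. f differentiable (at x)) \<and>
     (\<forall>x y. \<bar>deriv f x - deriv f y\<bar> \<le> L * \<bar>x - y\<bar>)"

definition inexact_gd_step ::
  "real \<Rightarrow> real \<Rightarrow> real \<Rightarrow> (real \<Rightarrow> real) \<Rightarrow> real \<Rightarrow> real \<Rightarrow> bool" where
  "inexact_gd_step L \<delta> h f x0 x1 \<longleftrightarrow>
     (\<exists>d0. \<bar>d0 - deriv f x0\<bar> \<le> \<delta> * \<bar>deriv f x0\<bar> \<and> x1 = x0 - h / L * d0)"

definition huber_fun :: "real \<Rightarrow> (real \<Rightarrow> real) \<Rightarrow> bool" where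
  "huber_fun L f \<longleftrightarrow>
     (\<exists>\<tau>>0. \<forall>x. f x = (if \<bar>x\<bar> < \<tau> then L / 2 * x\<^sup>2 else L * \<tau> * \<bar>x\<bar> - L * \<tau>\<^sup>2 / 2))"

definition quadratic_fun :: "(real \<Rightarrow> real) \<Rightarrow> bool" where
  "quadratic_fun f \<longleftrightarrow> (\<exists>a b c. a \<noteq> 0 \<and> (\<forall>x. f x = a * x\<^sup>2 + b * x + c))"

definition minimizer :: "(real \<Rightarrow> real) \<Rightarrow> real \<Rightarrow> bool" where
  "minimizer f xs \<longleftrightarrow> (\<forall>x. f xs \<le> f x)"

definition h_left :: "real \<Rightarrow> real" where
  "h_left \<delta> = 3 / (2 * (1 + \<delta>))"

definition h_right :: "real \<Rightarrow> real" where
  "h_right \<delta> = (3 * \<delta> + 2 - sqrt (4 - 3 * \<delta>\<^sup>2)) / (2 * \<delta> * (\<delta> + 1))"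

end

theory Submission
  imports Defs
begin

text \<open>On the linear part of a Huber function the gradient is constant, so the shortest
  admissible direction \<open>(1 - \<delta>) f'(x0)\<close> makes the slowest progress; starting so that the step
  lands exactly at the kink gives the largest final gradient. For large stepsizes the longest
  admissible direction \<open>(1 + \<delta>) f'(x0)\<close> on the quadratic with curvature \<open>L\<close> overshoots the
  minimizer the most.\<close>

section \<open>Differentiability of the squared positive part\<close>

text \<open>Dividing the bound by the increment leaves an error of at most
  \<open>C * \<bar>h\<bar>\<close> in the difference quotient, which is squeezed to 0. This gives
  derivatives at points where two branches of a function meet.\<close>

lemma DERIV_quadratic_bound:
  fixes f :: "real \<Rightarrow> real"
  assumes bound: "\<And>y. \<bar>f y - f x - D * (y - x)\<bar> \<le> C * (y - x)\<^sup>2"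
  shows "(f has_real_derivative D) (at x)"
proof -
  have "((\<lambda>h. (f (x + h) - f x) / h - D) \<longlongrightarrow> 0) (at 0)"
  proof (rule Lim_null_comparison)
    show "\<forall>\<^sub>F h in at 0. norm ((f (x + h) - f x) / h - D) \<le> C * \<bar>h\<bar>"
    proof (rule eventually_at_filter[THEN iffD2], rule always_eventually, intro allI impI)
      fix h :: real
      assume h: "h \<noteq> 0"
      have "norm ((f (x + h) - f x) / h - D) = \<bar>f (x + h) - f x - D * h\<bar> / \<bar>h\<bar>"
        using h by (simp add: diff_divide_distrib flip: abs_divide)
      also have "\<dots> \<le> C * h\<^sup>2 / \<bar>h\<bar>"
        using bound[of "x + h"] by (intro divide_right_mono) auto
      also have "\<dots> = C * \<bar>h\<bar>"
        using h by (simp add: power2_eq_square field_simps flip: abs_mult)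
      finally show "norm ((f (x + h) - f x) / h - D) \<le> C * \<bar>h\<bar>" .
    qed
    show "((\<lambda>h. C * \<bar>h\<bar>) \<longlongrightarrow> 0) (at 0)"
      by (rule tendsto_eq_intros refl | simp)+
  qed
  then show ?thesis
    by (simp add: DERIV_def LIM_zero_iff)
qed

text \<open>In each of the four sign cases the first-order remainder lies between 0 and
  \<open>(y - x)\<^sup>2\<close>, so the kink of \<open>max 0 x\<close> disappears on
  squaring.\<close>

lemma DERIV_pos_part_power2:
  "((\<lambda>x. (max 0 x)\<^sup>2) has_real_derivative 2 * max 0 x) (at x)" for x :: real
proof (rule DERIV_quadratic_bound[where C = 1])
  fix y :: real
  consider "0 \<le> x" "0 \<le> y" | "0 \<le> x" "y \<le> 0" | "x \<le> 0" "0 \<le> y" | "x \<le> 0" "y \<le> 0"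
    by linarith
  then show "\<bar>(max 0 y)\<^sup>2 - (max 0 x)\<^sup>2 - 2 * max 0 x * (y - x)\<bar> \<le> 1 * (y - x)\<^sup>2"
  proof cases
    case 1
    have "y\<^sup>2 - x\<^sup>2 - 2 * x * (y - x) = (y - x)\<^sup>2"
      by (simp add: power2_eq_square algebra_simps)
    with 1 show ?thesis by simp
  next
    case 2
    have "x * y \<le> 0"
      using 2 by (rule mult_nonneg_nonpos)
    have max: "max 0 x = x" "max 0 y = 0"
      using 2 by simp_all
    have eqs: "0\<^sup>2 - x\<^sup>2 - 2 * x * (y - x) = x\<^sup>2 - 2 * (x * y)"
      "(y - x)\<^sup>2 = x\<^sup>2 - 2 * (x * y) + y\<^sup>2"
      by (simp_all add: power2_eq_square algebra_simps)
    show ?thesis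
      unfolding max eqs mult_1 abs_le_iff using \<open>x * y \<le> 0\<close> zero_le_power2[of x] zero_le_power2[of y]
      by (intro conjI; linarith)
  next
    case 3
    then have "x * y \<le> 0"
      by (rule mult_nonpos_nonneg)
    then have "2 * (x * y) \<le> x\<^sup>2"
      using zero_le_power2[of x] by linarith
    moreover have "(y - x)\<^sup>2 = x\<^sup>2 - 2 * (x * y) + y\<^sup>2"
      by (simp add: power2_eq_square algebra_simps)
    ultimately show ?thesis
      using 3 by (simp add: max_absorb1)
  next
    case 4
    then show ?thesis by (simp add: max_absorb1)
  qed
qed

section \<open>Huber functions and their gradients\<close>

definition huber :: "real \<Rightarrow> real \<Rightarrow> real \<Rightarrow> real" where
  "huber L \<tau> x = (if \<bar>x\<bar> < \<tau> then L / 2 * x\<^sup>2 else L * \<tau> * \<bar>x\<bar> - L * \<tau>\<^sup>2 / 2)"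

lemma huber_fun_huber: "\<tau> > 0 \<Longrightarrow> huber_fun L (huber L \<tau>)"
  unfolding huber_fun_def huber_def by blast

text \<open>Beyond the kink, \<open>x\<^sup>2 - (x - \<tau>)\<^sup>2 = 2 * \<tau> * x -
  \<tau>\<^sup>2\<close> is affine: subtracting the squared excess on either side straightens the
  parabola. This form has no branches, so the differentiation rules apply at the kinks too.\<close>

lemma huber_eq_pos_parts:
  assumes "\<tau> > 0"
  shows "huber L \<tau> x = L / 2 * (x\<^sup>2 - (max 0 (x - \<tau>))\<^sup>2 - (max 0 (- x - \<tau>))\<^sup>2)"
proof -
  consider "\<bar>x\<bar> < \<tau>" | "\<tau> \<le> x" | "x \<le> - \<tau>" by linarith
  then show ?thesis
    using assms by cases (simp_all add: huber_def power2_eq_square algebra_simps)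
qed

text \<open>The gradient is \<open>L\<close> times the projection of \<open>x\<close> onto the
  interval from \<open>- \<tau>\<close> to \<open>\<tau>\<close>. The projection is monotone, which
  gives convexity, and nonexpansive, which gives smoothness with constant \<open>L\<close>.\<close>

lemma DERIV_huber:
  assumes "\<tau> > 0"
  shows "(huber L \<tau> has_real_derivative L * max (- \<tau>) (min \<tau> x)) (at x)"
proof -
  have "((\<lambda>x. L / 2 * (x\<^sup>2 - (max 0 (x - \<tau>))\<^sup>2 - (max 0 (- x - \<tau>))\<^sup>2)) has_real_derivative
      L / 2 * (2 * x - 2 * max 0 (x - \<tau>) * 1 - 2 * max 0 (- x - \<tau>) * (- 1))) (at x)"
    by (intro DERIV_cmult DERIV_diff DERIV_chain2[OF DERIV_pos_part_power2])
      (auto intro!: derivative_eq_intros)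
  moreover have "L / 2 * (2 * x - 2 * max 0 (x - \<tau>) * 1 - 2 * max 0 (- x - \<tau>) * (- 1)) =
      L * (x - max 0 (x - \<tau>) + max 0 (- x - \<tau>))"
    by (simp add: algebra_simps)
  moreover have "x - max 0 (x - \<tau>) + max 0 (- x - \<tau>) = max (- \<tau>) (min \<tau> x)"
    using assms by (simp add: max_def min_def)
  ultimately show ?thesis
    by (simp only: huber_eq_pos_parts[OF assms, abs_def])
qed

lemma deriv_huber: "\<tau> > 0 \<Longrightarrow> deriv (huber L \<tau>) x = L * max (- \<tau>) (min \<tau> x)"
  by (rule DERIV_imp_deriv[OF DERIV_huber])

lemma convex_on_huber:
  assumes "\<tau> > 0" "L \<ge> 0"
  shows "convex_on UNIV (huber L \<tau>)"
proof (rule convex_on_realI)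
  show "(huber L \<tau> has_real_derivative L * max (- \<tau>) (min \<tau> x)) (at x)" for x
    by (rule DERIV_huber[OF assms(1)])
  show "L * max (- \<tau>) (min \<tau> x) \<le> L * max (- \<tau>) (min \<tau> y)" if "x \<le> y" for x y
    using that assms by (intro mult_left_mono) auto
qed simp

lemma smooth_fun_huber:
  assumes "\<tau> > 0" "L \<ge> 0"
  shows "smooth_fun L (huber L \<tau>)"
  unfolding smooth_fun_def
proof (intro conjI allI)
  show "huber L \<tau> differentiable (at x)" for x
    using DERIV_huber[OF assms(1)] real_differentiable_def by blast
  show "\<bar>deriv (huber L \<tau>) x - deriv (huber L \<tau>) y\<bar> \<le> L * \<bar>x - y\<bar>" for x y
  proof -
    have "\<bar>max (- \<tau>) (min \<tau> x) - max (- \<tau>) (min \<tau> y)\<bar> \<le> \<bar>x - y\<bar>"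
      by (simp add: max_def min_def)
    then show ?thesis
      using assms by (simp add: deriv_huber abs_mult mult_left_mono flip: right_diff_distrib)
  qed
qed

lemma minimizer_huber:
  assumes "\<tau> > 0" "L \<ge> 0"
  shows "minimizer (huber L \<tau>) 0"
  unfolding minimizer_def
proof
  fix x
  have "L * \<tau>\<^sup>2 / 2 \<le> L * \<tau> * \<bar>x\<bar>" if "\<tau> \<le> \<bar>x\<bar>"
  proof -
    have "L * \<tau>\<^sup>2 \<le> L * \<tau> * \<bar>x\<bar>"
      using that assms by (simp add: power2_eq_square mult.assoc mult_left_mono)
    then show ?thesis
      using assms by (smt (verit, best) field_sum_of_halves mult_nonneg_nonneg zero_le_power2)
  qed
  then show "huber L \<tau> 0 \<le> huber L \<tau> x"
    using assms by (simp add: huber_def)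
qed

lemma huber_linear_part: "\<tau> > 0 \<Longrightarrow> \<tau> \<le> x \<Longrightarrow> huber L \<tau> x = L * \<tau> * x - L * \<tau>\<^sup>2 / 2"
  by (simp add: huber_def)

text \<open>The starting point is found backwards from the kink: on the linear part the direction
  \<open>(1 - \<delta>) * (L * \<tau>)\<close> moves the iterate by
  \<open>\<tau> * (h * (1 - \<delta>))\<close>.\<close>

lemma inexact_gd_step_huber:
  assumes "L > 0" "0 \<le> \<delta>" "\<delta> \<le> 1" "0 \<le> h" "\<tau> > 0"
  shows "inexact_gd_step L \<delta> h (huber L \<tau>) (\<tau> * (1 + h * (1 - \<delta>))) \<tau>"
proof -
  have "\<tau> \<le> \<tau> * (1 + h * (1 - \<delta>))"
    using assms by simp
  then have "deriv (huber L \<tau>) (\<tau> * (1 + h * (1 - \<delta>))) = L * \<tau>"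
    using assms by (simp add: deriv_huber)
  moreover have "\<bar>(1 - \<delta>) * (L * \<tau>) - L * \<tau>\<bar> \<le> \<delta> * \<bar>L * \<tau>\<bar>"
    using assms by (simp add: algebra_simps abs_mult)
  moreover have "\<tau> = \<tau> * (1 + h * (1 - \<delta>)) - h / L * ((1 - \<delta>) * (L * \<tau>))"
    using assms by (simp add: field_simps)
  ultimately show ?thesis
    unfolding inexact_gd_step_def by metis
qed

section \<open>The quadratic with curvature \<open>L\<close>\<close>

lemma DERIV_half_square:
  "((\<lambda>x. L / 2 * x\<^sup>2) has_real_derivative L * x) (at x)" for L x :: real
  by (auto intro!: derivative_eq_intros)

lemma deriv_half_square: "deriv (\<lambda>x. L / 2 * x\<^sup>2) x = L * x" for L x :: real
  by (rule DERIV_imp_deriv[OF DERIV_half_square])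

lemma deriv_half_square_power2:
  "1 / L * \<bar>deriv (\<lambda>x. L / 2 * x\<^sup>2) x\<bar>\<^sup>2 = L * x\<^sup>2" for L x :: real
  by (simp only: deriv_half_square) (simp add: power2_eq_square)

lemma quadratic_fun_half_square: "L \<noteq> 0 \<Longrightarrow> quadratic_fun (\<lambda>x. L / 2 * x\<^sup>2)"
  unfolding quadratic_fun_def by (intro exI[of _ "L / 2"] exI[of _ 0]) simp

lemma convex_on_half_square: "L \<ge> 0 \<Longrightarrow> convex_on UNIV (\<lambda>x::real. L / 2 * x\<^sup>2)"
  by (rule convex_on_realI[OF _ DERIV_half_square]) (auto intro: mult_left_mono)

lemma smooth_fun_half_square: "L \<ge> 0 \<Longrightarrow> smooth_fun L (\<lambda>x. L / 2 * x\<^sup>2)"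
  unfolding smooth_fun_def deriv_half_square
  using DERIV_half_square real_differentiable_def
  by (auto simp: abs_mult simp flip: right_diff_distrib)

lemma minimizer_half_square: "L \<ge> 0 \<Longrightarrow> minimizer (\<lambda>x. L / 2 * x\<^sup>2) 0"
  by (simp add: minimizer_def)

text \<open>Each such step multiplies the iterate by \<open>1 - h * (1 + \<delta>)\<close>. Starting
  at 1 suffices because function values and squared gradients all scale with the square of the
  starting point.\<close>

lemma inexact_gd_step_half_square:
  assumes "L > 0" "0 \<le> \<delta>"
  shows "inexact_gd_step L \<delta> h (\<lambda>x. L / 2 * x\<^sup>2) 1 (1 - h * (1 + \<delta>))"
  unfolding inexact_gd_step_def deriv_half_square
  using assms by (intro exI[of _ "(1 + \<delta>) * L"]) (simp add: algebra_simps abs_mult)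

text \<open>Keeps \<open>1 - h * (1 + \<delta>)\<close> away from \<open>0\<close>, where \<open>powi (- 2)\<close> has the junk value \<open>0\<close>.\<close>

lemma h_right_gt:
  assumes "0 < \<delta>"
  shows "1 / (1 + \<delta>) < h_right \<delta>"
proof -
  \<comment> \<open>With \<open>\<delta> + 2\<close> in place of the root, the numerator of
    \<open>h_right\<close> becomes \<open>2 * \<delta>\<close> and the quotient becomes
    \<open>1 / (1 + \<delta>)\<close>.\<close>
  have "sqrt (4 - 3 * \<delta>\<^sup>2) < \<delta> + 2"
  proof (rule real_less_lsqrt)
    show "4 - 3 * \<delta>\<^sup>2 < (\<delta> + 2)\<^sup>2"
      using assms by (simp add: power2_eq_square algebra_simps add_pos_pos)
  qed (use assms in simp)
  then have "2 * \<delta> < 3 * \<delta> + 2 - sqrt (4 - 3 * \<delta>\<^sup>2)"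
    by simp
  then have "2 * \<delta> / (2 * \<delta> * (\<delta> + 1)) < h_right \<delta>"
    unfolding h_right_def using assms by (intro divide_strict_right_mono) simp_all
  then show ?thesis
    using assms by (simp add: add.commute)
qed

section \<open>Attainment of the rates in the two stepsize regimes\<close>

theorem theorem2p4:
  fixes L \<delta> :: real
  assumes "L > 0" and "0 < \<delta>" and "\<delta> < 1"
  shows
    "(\<forall>h\<in>{0..<h_left \<delta>}. \<exists>f xs x0 x1.
        huber_fun L f \<and> convex_on UNIV f \<and> smooth_fun L f \<and> minimizer f xs \<and>
        f x0 > f xs \<and> inexact_gd_step L \<delta> h f x0 x1 \<and>
        1 / L * \<bar>deriv f x1\<bar>\<^sup>2 = 1 / (h * (1 - \<delta>) + 1 / 2) * (f x0 - f xs)) \<and>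
     (\<forall>h\<in>{0<..<h_left \<delta>}. \<exists>f xs x0 x1.
        huber_fun L f \<and> convex_on UNIV f \<and> smooth_fun L f \<and> minimizer f xs \<and>
        f x0 > f x1 \<and> inexact_gd_step L \<delta> h f x0 x1 \<and>
        1 / L * \<bar>deriv f x1\<bar>\<^sup>2 = 1 / (h * (1 - \<delta>)) * (f x0 - f x1)) \<and>
     (\<forall>h\<in>{h_right \<delta><..2 / (1 + \<delta>)}. \<exists>f xs x0 x1.
        quadratic_fun f \<and> convex_on UNIV f \<and> smooth_fun L f \<and> minimizer f xs \<and>
        f x0 > f xs \<and> inexact_gd_step L \<delta> h f x0 x1 \<and>
        1 / L * \<bar>deriv f x1\<bar>\<^sup>2 = 2 * (1 - h * (1 + \<delta>))\<^sup>2 * (f x0 - f xs)) \<and>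
     (\<forall>h\<in>{h_right \<delta><..<2 / (1 + \<delta>)}. \<exists>f xs x0 x1.
        quadratic_fun f \<and> convex_on UNIV f \<and> smooth_fun L f \<and> minimizer f xs \<and>
        f x0 > f x1 \<and> inexact_gd_step L \<delta> h f x0 x1 \<and>
        1 / L * \<bar>deriv f x1\<bar>\<^sup>2 = 2 / ((1 - h * (1 + \<delta>)) powi (- 2) - 1) * (f x0 - f x1))"
proof (intro conjI ballI)
  fix h
  assume h: "h \<in> {0..<h_left \<delta>}"
  \<comment> \<open>The threshold is normalized to 1, since both sides of the rate scale with its
    square. The gradient at the kink is then \<open>L\<close>, so the left side of the rate is
    \<open>L\<close>.\<close>
  define x0 where "x0 = 1 + h * (1 - \<delta>)"
  have nonneg: "0 \<le> h * (1 - \<delta>)"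
    using h assms by simp
  then have vals: "huber L 1 x0 = L * (h * (1 - \<delta>) + 1 / 2)" "huber L 1 0 = 0"
    by (simp_all add: x0_def huber_linear_part huber_def algebra_simps)
  have "huber L 1 0 < huber L 1 x0"
    unfolding vals using nonneg assms by (intro mult_pos_pos) auto
  moreover have "inexact_gd_step L \<delta> h (huber L 1) x0 1"
    using inexact_gd_step_huber[of L \<delta> h 1] assms h by (simp add: x0_def)
  moreover have "1 / L * \<bar>deriv (huber L 1) 1\<bar>\<^sup>2 =
      1 / (h * (1 - \<delta>) + 1 / 2) * (huber L 1 x0 - huber L 1 0)"
    unfolding vals using nonneg assms by (simp add: deriv_huber power2_eq_square)
  ultimately show "\<exists>f xs x0 x1.
      huber_fun L f \<and> convex_on UNIV f \<and> smooth_fun L f \<and> minimizer f xs \<and>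
      f x0 > f xs \<and> inexact_gd_step L \<delta> h f x0 x1 \<and>
      1 / L * \<bar>deriv f x1\<bar>\<^sup>2 = 1 / (h * (1 - \<delta>) + 1 / 2) * (f x0 - f xs)"
    using assms huber_fun_huber[of 1] convex_on_huber[of 1] smooth_fun_huber[of 1]
      minimizer_huber[of 1] by (metis less_imp_le zero_less_one)
next
  fix h
  assume h: "h \<in> {0<..<h_left \<delta>}"
  define x0 where "x0 = 1 + h * (1 - \<delta>)"
  have pos: "0 < h * (1 - \<delta>)"
    using h assms by simp
  \<comment> \<open>Between the kink and \<open>x0\<close> the function is affine with slope
    \<open>L\<close>, so the term \<open>1 / 2\<close> of the previous rate drops out. Positivity of
    \<open>h\<close> makes the decrease strict and the denominator nonzero.\<close>
  then have diff: "huber L 1 x0 - huber L 1 1 = L * (h * (1 - \<delta>))"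
    by (simp add: x0_def huber_linear_part algebra_simps)
  have "0 < huber L 1 x0 - huber L 1 1"
    unfolding diff using pos assms(1) by (rule mult_pos_pos[rotated])
  moreover have "inexact_gd_step L \<delta> h (huber L 1) x0 1"
    using inexact_gd_step_huber[of L \<delta> h 1] assms h by (simp add: x0_def)
  moreover have "1 / L * \<bar>deriv (huber L 1) 1\<bar>\<^sup>2 =
      1 / (h * (1 - \<delta>)) * (huber L 1 x0 - huber L 1 1)"
    unfolding diff using h assms by (simp add: deriv_huber power2_eq_square)
  ultimately show "\<exists>f xs x0 x1.
      huber_fun L f \<and> convex_on UNIV f \<and> smooth_fun L f \<and> minimizer f xs \<and>
      f x0 > f x1 \<and> inexact_gd_step L \<delta> h f x0 x1 \<and>
      1 / L * \<bar>deriv f x1\<bar>\<^sup>2 = 1 / (h * (1 - \<delta>)) * (f x0 - f x1)"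
    using assms huber_fun_huber[of 1] convex_on_huber[of 1] smooth_fun_huber[of 1]
      minimizer_huber[of 1] by (metis diff_gt_0_iff_gt less_imp_le zero_less_one)
next
  fix h
  assume "h \<in> {h_right \<delta><..2 / (1 + \<delta>)}"
  \<comment> \<open>Keeping \<open>f\<close> a variable preserves the shape of the existential goal,
    so the witnesses can be read off without undoing beta reduction.\<close>
  have "quadratic_fun f \<and> convex_on UNIV f \<and> smooth_fun L f \<and> minimizer f 0 \<and>
      f 1 > f 0 \<and> inexact_gd_step L \<delta> h f 1 (1 - h * (1 + \<delta>)) \<and>
      1 / L * \<bar>deriv f (1 - h * (1 + \<delta>))\<bar>\<^sup>2 = 2 * (1 - h * (1 + \<delta>))\<^sup>2 * (f 1 - f 0)"
    if "f = (\<lambda>x. L / 2 * x\<^sup>2)" for f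
    unfolding that deriv_half_square_power2
    using assms quadratic_fun_half_square convex_on_half_square smooth_fun_half_square
      minimizer_half_square inexact_gd_step_half_square by auto
  then show "\<exists>f xs x0 x1.
      quadratic_fun f \<and> convex_on UNIV f \<and> smooth_fun L f \<and> minimizer f xs \<and>
      f x0 > f xs \<and> inexact_gd_step L \<delta> h f x0 x1 \<and>
      1 / L * \<bar>deriv f x1\<bar>\<^sup>2 = 2 * (1 - h * (1 + \<delta>))\<^sup>2 * (f x0 - f xs)"
    by blast
next
  fix h
  assume h: "h \<in> {h_right \<delta><..<2 / (1 + \<delta>)}"
  \<comment> \<open>The factor by which the step multiplies the iterate. Below, \<open>q < 0\<close>
    expresses overshooting and makes \<open>q powi (- 2)\<close> a genuine inverse;
    \<open>- 1 < q\<close> makes the function value decrease.\<close>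
  define q where "q = 1 - h * (1 + \<delta>)"
  have "1 / (1 + \<delta>) < h" "h < 2 / (1 + \<delta>)"
    using h h_right_gt[OF assms(2)] by auto
  then have q: "- 1 < q" "q < 0"
    using assms by (simp_all add: q_def field_simps)
  then have q2: "q\<^sup>2 < 1"
    by (simp add: abs_square_less_1)
  have "q powi (- 2) - 1 = (1 - q\<^sup>2) / q\<^sup>2"
    using q by (simp add: power_int_minus divide_inverse left_diff_distrib)
  \<comment> \<open>In this form the denominator cancels against the decrease
    \<open>L / 2 * (1 - q\<^sup>2)\<close>, leaving the scaled squared gradient
    \<open>L * q\<^sup>2\<close>.\<close>
  then have rate: "2 / (q powi (- 2) - 1) = 2 * q\<^sup>2 / (1 - q\<^sup>2)"
    by simp
  have decrease: "L / 2 * q\<^sup>2 < L / 2 * 1\<^sup>2"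
    using q2 assms by simp
  have attained: "L * q\<^sup>2 = 2 / (q powi (- 2) - 1) * (L / 2 * 1\<^sup>2 - L / 2 * q\<^sup>2)"
  proof -
    have "L / 2 * 1\<^sup>2 - L / 2 * q\<^sup>2 = L / 2 * (1 - q\<^sup>2)"
      by (simp only: right_diff_distrib power_one)
    moreover have "2 * q\<^sup>2 / (1 - q\<^sup>2) * (L / 2 * (1 - q\<^sup>2)) = L * q\<^sup>2"
      using q2 by simp
    ultimately show ?thesis
      unfolding rate by (simp only:)
  qed
  have step: "inexact_gd_step L \<delta> h (\<lambda>x. L / 2 * x\<^sup>2) 1 q"
    unfolding q_def using assms by (intro inexact_gd_step_half_square) auto
  have "quadratic_fun f \<and> convex_on UNIV f \<and> smooth_fun L f \<and> minimizer f 0 \<and>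
      f 1 > f q \<and> inexact_gd_step L \<delta> h f 1 q \<and>
      1 / L * \<bar>deriv f q\<bar>\<^sup>2 = 2 / (q powi (- 2) - 1) * (f 1 - f q)"
    if "f = (\<lambda>x. L / 2 * x\<^sup>2)" for f
    unfolding that deriv_half_square_power2
    by (intro conjI decrease attained step quadratic_fun_half_square convex_on_half_square
        smooth_fun_half_square minimizer_half_square) (use assms in simp_all)
  then show "\<exists>f xs x0 x1.
      quadratic_fun f \<and> convex_on UNIV f \<and> smooth_fun L f \<and> minimizer f xs \<and>
      f x0 > f x1 \<and> inexact_gd_step L \<delta> h f x0 x1 \<and>
      1 / L * \<bar>deriv f x1\<bar>\<^sup>2 = 2 / ((1 - h * (1 + \<delta>)) powi (- 2) - 1) * (f x0 - f x1)"
    unfolding q_def[symmetric] by blast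
qed

end
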